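(* Consider the matrix completion model $Y_{ij}=E_{ij}(\theta_{ij}+\xi_{ij})$, $i\in[n]$, $j\in[m]$, where the $E_{ij}$ are i.i.d. Bernoulli variables with parameter $p\in(0,1]$, independent of $(\xi_{ij})$. Let the noise variables $\xi_{ij}$ be independent with Gaussian distribution $\mathcal{N}(0,\sigma^2)$, $\sigma>0$, and let the alphabets $\mathcal{D}_n$ and $\mathcal{D}_m$ contain the set $\{0,1\}$. There exists an absolute constant $C'>0$ such that $$\inf_{\hat\vartheta}\ \sup_{\theta\in\Theta(s_n,s_m)}\mathbb{P}_\theta\left\{\|\hat\vartheta-\theta\|^2\ge\frac{C'\sigma^2}{p}(n\vee m)\right\}\ge0.1$$ and $$\inf_{\hat\vartheta}\ \sup_{\theta\in\Theta(s_n,s_m)}\mathbb{E}_\theta\|\hat\vartheta-\theta\|^2\ge\frac{C'\sigma^2}{p}(n\vee m),$$ where $\|\cdot\|$ is the spectral norm and $\inf_{\hat\vartheta}$ is the infimum over all estimators (functions of $Y$) with values in $\mathbb{R}^{n\times m}$.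
   Context: Here $[i]=\{1,\dots,i\}$, $\|x\|_0$ is the number of non-zero components of a vector $x$, and $a\vee b=\max(a,b)$. $\mathbb{P}_\theta$, $\mathbb{E}_\theta$ denote probability and expectation under the distribution of $Y$ when the signal matrix is $\theta$. Let $n,m,k_n,k_m\ge1$ and $s_n,s_m$ be integers with $0\le s_n\le k_n$, $0\le s_m\le k_m$. Let $\mathcal{D}_n,\mathcal{D}_m\subset\mathbb{R}$ (alphabets). For $1\le s_n\le k_n$, $$\mathcal{A}_{s_n}=\{A\in\mathcal{D}_n^{n\times k_n}:\ \|A_{i\cdot}\|_0\le s_n\text{ for all }i\in[n]\},$$ where $A_{i\cdot}$ is the $i$th row; for $s_n=0$ it is assumed that $n=k_n$ and $\mathcal{A}_{s_n}$ contains only the $n\times n$ identity matrix. $\mathcal{A}_{s_m}$ is defined analogously with $n$ replaced by $m$. The structured class is $$\Theta(s_n,s_m)=\{\theta=XBZ^T:\ X\in\mathcal{A}_{s_n},\ B\in\mathbb{R}^{k_n\times k_m},\ Z\in\mathcal{A}_{s_m}\}\subset\mathbb{R}^{n\times m}.$$ *)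

theory Defs
  imports "HOL-Probability.Probability" "Jordan_Normal_Form.Matrix"
begin

no_notation Finite_Cartesian_Product.vec_nth (infixl "$" 90)
hide_const (open) Finite_Cartesian_Product.mat Finite_Cartesian_Product.row

definition l0_norm :: "real vec \<Rightarrow> nat" where
  "l0_norm v = card {j. j < dim_vec v \<and> v $ j \<noteq> 0}"

definition euclid_norm :: "real vec \<Rightarrow> real" where
  "euclid_norm v = L2_set (\<lambda>i. v $ i) {..<dim_vec v}"

text \<open>The spectral norm is the operator norm for the Euclidean norms on both sides.\<close>

definition spectral_norm :: "real mat \<Rightarrow> real" where
  "spectral_norm A =
     (SUP v\<in>{v \<in> carrier_vec (dim_col A). euclid_norm v \<le> 1}. euclid_norm (A *\<^sub>v v))"

text \<open>For \<open>s = 0\<close> the class is meant to be used only with \<open>k = n\<close>.\<close>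

definition sparse_class :: "nat \<Rightarrow> nat \<Rightarrow> nat \<Rightarrow> real set \<Rightarrow> real mat set" where
  "sparse_class n k s D =
     (if s = 0 then {1\<^sub>m n}
      else {A \<in> carrier_mat n k. elements_mat A \<subseteq> D \<and> (\<forall>i<n. l0_norm (row A i) \<le> s)})"

definition structured_class ::
    "nat \<Rightarrow> nat \<Rightarrow> nat \<Rightarrow> nat \<Rightarrow> nat \<Rightarrow> nat \<Rightarrow> real set \<Rightarrow> real set \<Rightarrow> real mat set" where
  "structured_class n m k\<^sub>n k\<^sub>m s\<^sub>n s\<^sub>m D\<^sub>n D\<^sub>m =
     {X * B * Z\<^sup>T | X B Z. X \<in> sparse_class n k\<^sub>n s\<^sub>n D\<^sub>n \<and> B \<in> carrier_mat k\<^sub>n k\<^sub>m \<and>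
                      Z \<in> sparse_class m k\<^sub>m s\<^sub>m D\<^sub>m}"

abbreviation index_set :: "nat \<Rightarrow> nat \<Rightarrow> (nat \<times> nat) set" where
  "index_set n m \<equiv> {..<n} \<times> {..<m}"

text \<open>The observation \<open>Y\<close> is a real array indexed by \<open>index_set n m\<close>, that is, a point of the
  following measurable space.\<close>

abbreviation obs_space :: "nat \<Rightarrow> nat \<Rightarrow> (nat \<times> nat \<Rightarrow> real) measure" where
  "obs_space n m \<equiv> PiM (index_set n m) (\<lambda>_. borel)"

text \<open>Joint law of the mask \<open>E\<close> and the noise \<open>\<xi>\<close>; \<open>\<sigma>\<close> is the standard deviation, so each
  \<open>\<xi> (i, j)\<close> has variance \<open>\<sigma>\<^sup>2\<close>.\<close>

definition mask_noise ::
    "nat \<Rightarrow> nat \<Rightarrow> real \<Rightarrow> real \<Rightarrow> ((nat \<times> nat \<Rightarrow> bool) \<times> (nat \<times> nat \<Rightarrow> real)) measure" where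
  "mask_noise n m p \<sigma> =
     PiM (index_set n m) (\<lambda>_. measure_pmf (bernoulli_pmf p)) \<Otimes>\<^sub>M
     PiM (index_set n m) (\<lambda>_. density lborel (\<lambda>x. ennreal (normal_density 0 \<sigma> x)))"

definition observe ::
    "nat \<Rightarrow> nat \<Rightarrow> real mat \<Rightarrow> (nat \<times> nat \<Rightarrow> bool) \<times> (nat \<times> nat \<Rightarrow> real) \<Rightarrow> nat \<times> nat \<Rightarrow> real" where
  "observe n m \<theta> = (\<lambda>(E, \<xi>). \<lambda>ij\<in>index_set n m. of_bool (E ij) * (\<theta> $$ ij + \<xi> ij))"

text \<open>The law of \<open>Y\<close> under \<open>\<theta>\<close>.\<close>

definition law_Y :: "nat \<Rightarrow> nat \<Rightarrow> real \<Rightarrow> real \<Rightarrow> real mat \<Rightarrow> (nat \<times> nat \<Rightarrow> real) measure" where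
  "law_Y n m p \<sigma> \<theta> = distr (mask_noise n m p \<sigma>) (obs_space n m) (observe n m \<theta>)"

text \<open>Measurability of a matrix-valued map is entrywise. Estimators may depend on all parameters
  of the model except \<open>\<theta>\<close>.\<close>

definition estimators :: "nat \<Rightarrow> nat \<Rightarrow> ((nat \<times> nat \<Rightarrow> real) \<Rightarrow> real mat) set" where
  "estimators n m =
     {\<delta>. (\<forall>y. \<delta> y \<in> carrier_mat n m) \<and>
         (\<forall>i<n. \<forall>j<m. (\<lambda>y. \<delta> y $$ (i, j)) \<in> borel_measurable (obs_space n m))}"

lemma observe_measurable: "observe n m \<theta> \<in> measurable (mask_noise n m p \<sigma>) (obs_space n m)"
  unfolding observe_def mask_noise_def case_prod_beta by measurable

lemma prob_space_law_Y:
  assumes "0 < \<sigma>"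
  shows "prob_space (law_Y n m p \<sigma> \<theta>)"
proof -
  interpret N: prob_space "density lborel (\<lambda>x. ennreal (normal_density 0 \<sigma> x))"
    using assms by (rule prob_space_normal_density)
  interpret A: product_prob_space "\<lambda>_. measure_pmf (bernoulli_pmf p)" "index_set n m" ..
  interpret B: product_prob_space
    "\<lambda>_. density lborel (\<lambda>x. ennreal (normal_density 0 \<sigma> x))" "index_set n m" ..
  interpret AB: pair_prob_space
    "PiM (index_set n m) (\<lambda>_. measure_pmf (bernoulli_pmf p))"
    "PiM (index_set n m) (\<lambda>_. density lborel (\<lambda>x. ennreal (normal_density 0 \<sigma> x)))" ..
  have "prob_space (mask_noise n m p \<sigma>)"
    unfolding mask_noise_def by (rule AB.prob_space_axioms)
  then show ?thesis
    unfolding law_Y_def by (rule prob_space.prob_space_distr) (rule observe_measurable)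
qed

end

theory Submission
  imports Defs
begin

text \<open>The class contains every \<open>b x z\<^sup>T\<close> with 0-1 vectors \<open>x\<close>, \<open>z\<close>. With \<open>z\<close> (or \<open>x\<close>) a unit vector,
  these are the matrices that vanish outside the longer of the first column and the first row and
  have entries in \<open>{0, b}\<close> there. The squared spectral norm dominates the sum of squares along such a
  line, so it suffices to estimate \<open>max n m\<close> bits. Flipping one bit moves the law of \<open>Y\<close> in total
  variation by at most \<open>p b / \<sigma> \<le> 1 / 4\<close> when \<open>b = \<sigma> / (4 \<surd>p)\<close>. Averaging over all bit patterns
  (Assouad's argument) gives a pattern for which the expected number of wrong bits is at least 3/8 of
  their number. As the number of wrong bits never exceeds the number of bits, it is at least a quarter of
  it with probability at least 1/8.\<close>

section \<open>Effect of one flipped entry on the law of the observation\<close>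

text \<open>Up to \<open>b / 2\<close> the density with mean 0 is the larger one, beyond it the shifted one is. So the
  half-line up to \<open>b / 2\<close> is the worst event, and there the two laws differ by the mass of an
  interval of length \<open>b\<close>.\<close>

lemma normal_shift_le:
  fixes b \<sigma> :: real
  assumes "0 < \<sigma>" "0 \<le> b" and A: "A \<in> sets borel"
  defines "\<gamma> \<equiv> density lborel (\<lambda>x. ennreal (normal_density 0 \<sigma> x))"
  shows "emeasure \<gamma> A \<le> emeasure \<gamma> {x. b + x \<in> A} + ennreal (b / \<sigma>)"
proof -
  interpret prob_space \<gamma>
    unfolding \<gamma>_def using assms(1) by (rule prob_space_normal_density)
  have sets_\<gamma> [measurable_cong]: "sets \<gamma> = sets borel" by (simp add: \<gamma>_def)
  have space_\<gamma>: "space \<gamma> = UNIV" by (simp add: \<gamma>_def)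
  have "distributed \<gamma> lborel (\<lambda>x. x) (\<lambda>x. ennreal (normal_density 0 \<sigma> x))"
    unfolding distributed_def by (auto simp: \<gamma>_def distr_id2)
  from normal_density_affine[OF this assms(1), of 1 b]
  have "distributed \<gamma> lborel (\<lambda>x. b + x) (\<lambda>x. ennreal (normal_density b \<sigma> x))" by simp
  then have distr: "distr \<gamma> lborel (\<lambda>x. b + x) = density lborel (\<lambda>x. ennreal (normal_density b \<sigma> x))"
    by (simp add: distributed_def)
  \<comment> \<open>\<open>\<gamma>'\<close> is the law of \<open>b + x\<close> for \<open>x\<close>
    distributed as \<open>\<gamma>\<close>, so the claim compares the masses that the two laws give
    to \<open>A\<close>.\<close>
  define \<gamma>' where "\<gamma>' = density lborel (\<lambda>x. ennreal (normal_density b \<sigma> x))"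
  interpret N': prob_space \<gamma>'
    unfolding \<gamma>'_def using assms(1) by (rule prob_space_normal_density)
  have sets_\<gamma>' [measurable_cong]: "sets \<gamma>' = sets borel" by (simp add: \<gamma>'_def)
  have space_\<gamma>': "space \<gamma>' = UNIV" by (simp add: \<gamma>'_def)
  have em': "emeasure \<gamma>' B = emeasure \<gamma> {x. b + x \<in> B}" if "B \<in> sets borel" for B
    using that unfolding \<gamma>'_def distr[symmetric]
    by (subst emeasure_distr) (auto simp: space_\<gamma> vimage_def)
  have m': "measure \<gamma>' B = measure \<gamma> {x. b + x \<in> B}" if "B \<in> sets borel" for B
    using em'[OF that] by (simp add: measure_def)
  \<comment> \<open>The last factor \<open>b - 2 * x\<close> changes sign at \<open>b / 2\<close>,
    which is where the two densities cross.\<close>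
  have sq: "(x - b)\<^sup>2 = x\<^sup>2 + b * (b - 2 * x)" for x :: real
    by (simp add: power2_eq_square algebra_simps)
  have le1: "normal_density b \<sigma> x \<le> normal_density 0 \<sigma> x" if "x \<le> b / 2" for x
  proof -
    have "x\<^sup>2 \<le> (x - b)\<^sup>2" using that assms(2) by (simp add: sq)
    then show ?thesis using assms(1)
      by (simp add: normal_density_def divide_right_mono mult_left_mono)
  qed
  have le2: "normal_density 0 \<sigma> x \<le> normal_density b \<sigma> x" if "x > b / 2" for x
  proof -
    have "(x - b)\<^sup>2 \<le> x\<^sup>2" using that assms(2) by (simp add: sq mult_nonneg_nonpos)
    then show ?thesis using assms(1)
      by (simp add: normal_density_def divide_right_mono mult_left_mono)
  qed
  define H where "H = {..b / 2}"
  have H [measurable]: "H \<in> sets borel" by (simp add: H_def)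
  note A [measurable]
  have 1: "measure \<gamma> (A - H) \<le> measure \<gamma>' (A - H)"
  proof -
    have "emeasure \<gamma> (A - H) \<le> emeasure \<gamma>' (A - H)"
      unfolding \<gamma>_def \<gamma>'_def H_def using A
      by (subst (1 2) emeasure_density)
         (auto intro!: nn_integral_mono simp: le2 split: split_indicator)
    then show ?thesis by (simp add: emeasure_eq_measure N'.emeasure_eq_measure)
  qed
  have 2: "measure \<gamma>' (H - A) \<le> measure \<gamma> (H - A)"
  proof -
    have "emeasure \<gamma>' (H - A) \<le> emeasure \<gamma> (H - A)"
      unfolding \<gamma>_def \<gamma>'_def H_def using A
      by (subst (1 2) emeasure_density)
         (auto intro!: nn_integral_mono simp: le1 split: split_indicator)
    then show ?thesis by (simp add: emeasure_eq_measure N'.emeasure_eq_measure)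
  qed
  \<comment> \<open>In this decomposition the difference of the two laws on \<open>A\<close> splits
    into three terms. By \<open>1\<close> and \<open>2\<close> the terms for \<open>A - H\<close>
    and \<open>H - A\<close> only lower it, so the difference on \<open>H\<close> is an upper
    bound.\<close>
  have d: "measure M A = measure M (A - H) + measure M H - measure M (H - A)"
    if "prob_space M" "sets M = sets borel" for M :: "real measure"
  proof -
    interpret M: prob_space M by fact
    have s: "A \<in> sets M" "H \<in> sets M" using that(2) by auto
    show ?thesis
      using s M.finite_measure_Diff'[OF s] M.finite_measure_Diff'[OF s(2,1)]
      by (simp add: Int_commute)
  qed
  \<comment> \<open>The peak of the density is \<open>1 / (\<sigma> * sqrt (2 * pi))\<close>;
    dropping the factor \<open>sqrt (2 * pi) \<ge> 1\<close> costs only a constant.\<close>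
  have dens: "normal_density 0 \<sigma> x \<le> 1 / \<sigma>" for x
  proof -
    have "exp (- (x\<^sup>2 / (2 * \<sigma>\<^sup>2))) \<le> 1" by simp
    moreover have "\<sigma> \<le> sqrt (2 * pi * \<sigma>\<^sup>2)"
      using assms(1) pi_ge_two by (intro real_le_rsqrt) (simp add: power2_eq_square)
    ultimately show ?thesis using assms(1)
      unfolding normal_density_def
      by (simp add: frac_le)
  qed
  have 3: "measure \<gamma> H - measure \<gamma>' H \<le> b / \<sigma>"
  proof -
    \<comment> \<open>Moving \<open>H\<close> back by \<open>b\<close> expresses both masses through
      \<open>\<gamma>\<close>, and what remains is the mass of an interval of length
      \<open>b\<close>.\<close>
    have "{x. b + x \<in> H} = {..-b/2}" by (auto simp: H_def field_simps)
    then have "measure \<gamma> H - measure \<gamma>' H = measure \<gamma> (H - {..-b/2})"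
      using assms(2) by (subst finite_measure_Diff) (auto simp: m' H_def)
    also have "H - {..-b/2} = {-b/2<..b/2}" by (auto simp: H_def)
    also have "measure \<gamma> {-b/2<..b/2} \<le> b / \<sigma>"
    proof -
      have "emeasure \<gamma> {-b/2<..b/2} \<le> (\<integral>\<^sup>+x. ennreal (1 / \<sigma>) * indicator {-b/2<..b/2} x \<partial>lborel)"
        unfolding \<gamma>_def by (subst emeasure_density)
          (auto intro!: nn_integral_mono ennreal_leI dens split: split_indicator)
      also have "\<dots> = ennreal (b / \<sigma>)"
        using assms(1,2) by (subst nn_integral_cmult_indicator) (auto simp: ennreal_mult'[symmetric])
      finally show ?thesis using assms(1,2) by (simp add: emeasure_eq_measure)
    qed
    finally show ?thesis .
  qed
  have "measure \<gamma> A \<le> measure \<gamma>' A + b / \<sigma>"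
    using 1 2 3 d[OF prob_space_axioms sets_\<gamma>] d[OF N'.prob_space_axioms sets_\<gamma>'] by simp
  then show ?thesis
    using assms(1,2) by (simp add: emeasure_eq_measure m'[OF A] ennreal_plus[symmetric] ennreal_leI del: ennreal_plus)
qed

text \<open>By Fubini, freeze the mask and all noise variables except the one at \<open>k\<close>.
  If entry \<open>k\<close> is hidden, both signals give the same observation; if it is revealed,
  changing the signal amounts to shifting one Gaussian by \<open>b\<close>, at cost at most
  \<open>b / \<sigma>\<close>. Integrating over the mask multiplies this cost by
  \<open>p\<close>.\<close>

lemma law_Y_flip_le:
  fixes \<theta> \<theta>' :: "real mat"
  assumes "0 < \<sigma>" "0 \<le> b" "0 \<le> p" "p \<le> 1"
    and k: "k \<in> index_set n m"
    and flip: "\<theta>' $$ k = \<theta> $$ k + b"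
    and same: "\<And>l. l \<in> index_set n m \<Longrightarrow> l \<noteq> k \<Longrightarrow> \<theta>' $$ l = \<theta> $$ l"
    and A: "A \<in> sets (obs_space n m)"
  shows "emeasure (law_Y n m p \<sigma> \<theta>) A \<le> emeasure (law_Y n m p \<sigma> \<theta>') A + ennreal (p * (b / \<sigma>))"
proof -
  define \<gamma> where "\<gamma> = density lborel (\<lambda>x. ennreal (normal_density 0 \<sigma> x))"
  define I where "I = index_set n m"
  define ME where "ME = PiM I (\<lambda>_. measure_pmf (bernoulli_pmf p))"
  define MX where "MX = PiM I (\<lambda>_. \<gamma>)"
  have finI: "finite I" by (simp add: I_def)
  interpret N: prob_space \<gamma>
    unfolding \<gamma>_def using assms(1) by (rule prob_space_normal_density)
  interpret E: product_prob_space "\<lambda>_. measure_pmf (bernoulli_pmf p)" I ..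
  interpret X: product_prob_space "\<lambda>_. \<gamma>" I ..
  interpret E: prob_space ME unfolding ME_def by (rule E.prob_space_axioms)
  interpret X: prob_space MX unfolding MX_def by (rule X.prob_space_axioms)
  have mask: "mask_noise n m p \<sigma> = ME \<Otimes>\<^sub>M MX"
    by (simp add: mask_noise_def ME_def MX_def I_def \<gamma>_def)
  have obs [measurable]: "observe n m t \<in> measurable (ME \<Otimes>\<^sub>M MX) (PiM I (\<lambda>_. borel))" for t
    using observe_measurable[of n m t p \<sigma>] by (simp add: mask I_def)
  have A' [measurable]: "A \<in> sets (PiM I (\<lambda>_. borel))" using A by (simp add: I_def)
  have law: "emeasure (law_Y n m p \<sigma> t) A
      = (\<integral>\<^sup>+e. \<integral>\<^sup>+x. indicator A (observe n m t (e, x)) \<partial>MX \<partial>ME)" for t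
  proof -
    have "emeasure (law_Y n m p \<sigma> t) A = (\<integral>\<^sup>+w. indicator A (observe n m t w) \<partial>(ME \<Otimes>\<^sub>M MX))"
      unfolding law_Y_def mask I_def[symmetric]
      using nn_integral_distr[OF obs, of "indicator A"] by simp
    also have "\<dots> = (\<integral>\<^sup>+e. \<integral>\<^sup>+x. indicator A (observe n m t (e, x)) \<partial>MX \<partial>ME)"
      by (rule X.nn_integral_fst[symmetric]) measurable
    finally show ?thesis .
  qed
  \<comment> \<open>The two observations differ only when entry \<open>k\<close> is revealed, which brings in the factor \<open>p\<close>.\<close>
  have inner: "(\<integral>\<^sup>+x. indicator A (observe n m \<theta> (e, x)) \<partial>MX)
      \<le> (\<integral>\<^sup>+x. indicator A (observe n m \<theta>' (e, x)) \<partial>MX) + ennreal (b / \<sigma>) * of_bool (e k)"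
    if e: "e \<in> space ME" for e
  proof (cases "e k")
    case False
    then have "of_bool (e l) * (\<theta> $$ l + x l) = of_bool (e l) * (\<theta>' $$ l + x l)"
      if "l \<in> index_set n m" for l x
      using same[OF that] by (cases "l = k") auto
    then have "observe n m \<theta> (e, x) = observe n m \<theta>' (e, x)" for x
      unfolding observe_def prod.case by (intro restrict_ext) blast
    then show ?thesis using False by simp
  next
    case True
    \<comment> \<open>The noise at \<open>k\<close> is separated from the noise at the other indices
      \<open>I'\<close>, so that it can be integrated innermost.\<close>
    define I' where "I' = I - {k}"
    have I: "I = insert k I'" "finite I'" "k \<notin> I'" using k by (auto simp: I'_def I_def)
    interpret X': product_prob_space "\<lambda>_. \<gamma>" I' ..
    have [measurable]: "(\<lambda>x. indicator A (observe n m t (e, x)) :: ennreal) \<in> borel_measurable MX" for t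
    proof -
      have "(\<lambda>x. observe n m t (e, x)) \<in> measurable MX (PiM I (\<lambda>_. borel))"
        by (rule measurable_compose[OF measurable_Pair1'[OF e] obs])
      then show ?thesis by measurable
    qed
    have split: "(\<integral>\<^sup>+x. indicator A (observe n m t (e, x)) \<partial>MX) =
        (\<integral>\<^sup>+x. \<integral>\<^sup>+z. indicator A (observe n m t (e, x(k := z))) \<partial>\<gamma> \<partial>PiM I' (\<lambda>_. \<gamma>))" for t
    proof -
      have "(\<lambda>x. indicator A (observe n m t (e, x)) :: ennreal) \<in> borel_measurable MX" by measurable
      then show ?thesis unfolding MX_def I(1)
        by (subst X.product_nn_integral_insert[OF I(2,3)]) auto
    qed
    have "(\<integral>\<^sup>+x. indicator A (observe n m \<theta> (e, x)) \<partial>MX)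
        \<le> (\<integral>\<^sup>+x. (\<integral>\<^sup>+z. indicator A (observe n m \<theta>' (e, x(k := z))) \<partial>\<gamma>) + ennreal (b / \<sigma>) \<partial>PiM I' (\<lambda>_. \<gamma>))"
      unfolding split
    proof (rule nn_integral_mono)
      fix x assume x: "x \<in> space (PiM I' (\<lambda>_. \<gamma>))"
      \<comment> \<open>\<open>B\<close> is the section of the event in the noise variable at
        \<open>k\<close>, all other variables being fixed.\<close>
      define B where "B = {z. observe n m \<theta> (e, x(k := z)) \<in> A}"
      have "(\<lambda>z. x(k := z)) \<in> measurable \<gamma> MX"
        unfolding MX_def I(1) using x
        by (intro measurable_fun_upd[where J = I'])  auto
      then have "(\<lambda>z. observe n m \<theta> (e, x(k := z))) \<in> measurable \<gamma> (PiM I (\<lambda>_. borel))"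
        by (rule measurable_compose[OF _ measurable_compose[OF measurable_Pair1'[OF e] obs]])
      from measurable_sets[OF this A'] have B: "B \<in> sets borel"
        by (simp add: \<gamma>_def B_def vimage_def)
      have B': "observe n m \<theta>' (e, x(k := z)) \<in> A \<longleftrightarrow> b + z \<in> B" for z
      proof -
        \<comment> \<open>Signal and noise enter only through their sum, so raising the signal at
          \<open>k\<close> by \<open>b\<close> is the same as raising the noise there by
          \<open>b\<close>.\<close>
        have "observe n m \<theta>' (e, x(k := z)) = observe n m \<theta> (e, x(k := b + z))"
          unfolding observe_def prod.case using flip
          by (intro restrict_ext) (metis (no_types, lifting) same fun_upd_apply add.assoc)
        then show ?thesis by (simp add: B_def)
      qed
      have [measurable]: "{z. b + z \<in> B} \<in> sets borel"
        using measurable_sets[OF _ B, of "(+) b" borel] by (simp add: vimage_def)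
      have "(\<integral>\<^sup>+z. indicator A (observe n m \<theta> (e, x(k := z))) \<partial>\<gamma>) = emeasure \<gamma> B"
      proof -
        have "(indicator A (observe n m \<theta> (e, x(k := z))) :: ennreal) = indicator B z" for z
          by (simp add: B_def indicator_def)
        then show ?thesis using B by (simp add: \<gamma>_def)
      qed
      moreover have "(\<integral>\<^sup>+z. indicator A (observe n m \<theta>' (e, x(k := z))) \<partial>\<gamma>) = emeasure \<gamma> {z. b + z \<in> B}"
      proof -
        have "(indicator A (observe n m \<theta>' (e, x(k := z))) :: ennreal) = indicator {z. b + z \<in> B} z" for z
          by (simp add: B' indicator_def)
        then show ?thesis by (simp add: \<gamma>_def)
      qed
      ultimately show "(\<integral>\<^sup>+z. indicator A (observe n m \<theta> (e, x(k := z))) \<partial>\<gamma>)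
          \<le> (\<integral>\<^sup>+z. indicator A (observe n m \<theta>' (e, x(k := z))) \<partial>\<gamma>) + ennreal (b / \<sigma>)"
        using normal_shift_le[OF assms(1,2) B] by (simp add: \<gamma>_def)
    qed
    also have "\<dots> = (\<integral>\<^sup>+x. indicator A (observe n m \<theta>' (e, x)) \<partial>MX) + ennreal (b / \<sigma>)"
      unfolding split
    proof (subst nn_integral_add)
      \<comment> \<open>To separate the constant from the integral, the inner integral must be
        measurable in the remaining noise. This follows from joint measurability of
        \<open>(x, z) \<mapsto> x(k := z)\<close>.\<close>
      have "(\<lambda>x. indicator A (observe n m \<theta>' (e, x)) :: ennreal) \<in> borel_measurable (PiM (insert k I') (\<lambda>_. \<gamma>))"
        unfolding I(1)[symmetric] MX_def[symmetric] by measurable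
      then have "(\<lambda>(x, z). indicator A (observe n m \<theta>' (e, x(k := z))) :: ennreal)
          \<in> borel_measurable (PiM I' (\<lambda>_. \<gamma>) \<Otimes>\<^sub>M \<gamma>)"
        unfolding case_prod_beta
        by (rule measurable_compose[rotated]) (use measurable_add_dim[of k I' "\<lambda>_. \<gamma>"] in \<open>simp add: case_prod_beta\<close>)
      then show "(\<lambda>x. \<integral>\<^sup>+z. indicator A (observe n m \<theta>' (e, x(k := z))) \<partial>\<gamma>)
          \<in> borel_measurable (PiM I' (\<lambda>_. \<gamma>))"
        by (rule N.borel_measurable_nn_integral_fst[of "\<lambda>(x, z). _ x z", simplified])
    qed (simp_all add: X'.emeasure_space_1)
    finally show ?thesis using True by simp
  qed
  have k': "k \<in> I" using k by (simp add: I_def)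
  have proj: "(\<lambda>e. e k) \<in> measurable ME (measure_pmf (bernoulli_pmf p))"
    unfolding ME_def by (rule measurable_component_singleton[OF k'])
  have meas: "(\<lambda>e. \<integral>\<^sup>+x. indicator A (observe n m t (e, x)) \<partial>MX) \<in> borel_measurable ME" for t
    by (rule X.borel_measurable_nn_integral_fst) measurable
  have meas': "(\<lambda>e. ennreal (b / \<sigma>) * of_bool (e k)) \<in> borel_measurable ME"
    by (rule measurable_compose[OF proj]) simp
  have "emeasure (law_Y n m p \<sigma> \<theta>) A
      \<le> (\<integral>\<^sup>+e. (\<integral>\<^sup>+x. indicator A (observe n m \<theta>' (e, x)) \<partial>MX) + ennreal (b / \<sigma>) * of_bool (e k) \<partial>ME)"
    unfolding law by (rule nn_integral_mono) (rule inner)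
  also have "\<dots> = emeasure (law_Y n m p \<sigma> \<theta>') A + (\<integral>\<^sup>+e. ennreal (b / \<sigma>) * of_bool (e k) \<partial>ME)"
    unfolding law by (rule nn_integral_add[OF meas meas'])
  \<comment> \<open>The mask at \<open>k\<close> has a Bernoulli marginal, so the integral of
    \<open>of_bool (e k)\<close> is \<open>p\<close>.\<close>
  also have "(\<integral>\<^sup>+e. ennreal (b / \<sigma>) * of_bool (e k) \<partial>ME)
      = (\<integral>\<^sup>+v. ennreal (b / \<sigma>) * of_bool v \<partial>distr ME (measure_pmf (bernoulli_pmf p)) (\<lambda>e. e k))"
    using proj by (subst nn_integral_distr) auto
  also have "distr ME (measure_pmf (bernoulli_pmf p)) (\<lambda>e. e k) = measure_pmf (bernoulli_pmf p)"
    unfolding ME_def by (rule E.PiM_component[OF k'])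
  also have "(\<integral>\<^sup>+v. ennreal (b / \<sigma>) * of_bool v \<partial>measure_pmf (bernoulli_pmf p)) = ennreal (p * (b / \<sigma>))"
    using assms(1-4) by (subst nn_integral_bernoulli_pmf) (auto simp: ennreal_mult[symmetric] mult.commute)
  finally show ?thesis .
qed

section \<open>Spectral norm: operator bound, measurability, rows and columns\<close>

lemma euclid_norm_nonneg [simp]: "0 \<le> euclid_norm v"
  by (simp add: euclid_norm_def L2_set_nonneg)

lemma euclid_norm_smult: "euclid_norm (c \<cdot>\<^sub>v v) = \<bar>c\<bar> * euclid_norm v"
  by (simp add: euclid_norm_def L2_set_def power_mult_distrib sum_distrib_left[symmetric] real_sqrt_mult)

lemma abs_vec_nth_le_euclid_norm: "j < dim_vec v \<Longrightarrow> \<bar>v $ j\<bar> \<le> euclid_norm v"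
  unfolding euclid_norm_def L2_set_def
  by (rule real_le_rsqrt) (use member_le_sum[of j "{..<dim_vec v}" "\<lambda>i. (v $ i)\<^sup>2"] in auto)

lemma mult_mat_vec_nth: "i < dim_row A \<Longrightarrow> dim_vec v = dim_col A \<Longrightarrow>
    (A *\<^sub>v v) $ i = (\<Sum>j<dim_col A. A $$ (i, j) * v $ j)"
  by (simp add: scalar_prod_def atLeast0LessThan)

lemma mult_mat_unit_vec:
  fixes A :: "real mat"
  assumes "A \<in> carrier_mat n m" "j < m"
  shows "A *\<^sub>v unit_vec m j = col A j"
  using assms by (intro eq_vecI) (auto simp: scalar_prod_right_unit[of j m])

text \<open>A supremum of reals is informative only when the set is bounded. The coordinates of a
  vector in the unit ball are at most 1 in absolute value, so the sum of all absolute entries of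
  \<open>A\<close> is a bound.\<close>

lemma bdd_above_spectral_norm:
  "bdd_above ((\<lambda>v. euclid_norm (A *\<^sub>v v)) ` {v \<in> carrier_vec (dim_col A). euclid_norm v \<le> 1})"
proof (rule bdd_aboveI2)
  fix v :: "real vec" assume v: "v \<in> {v \<in> carrier_vec (dim_col A). euclid_norm v \<le> 1}"
  have "euclid_norm (A *\<^sub>v v) \<le> (\<Sum>i<dim_row A. \<bar>(A *\<^sub>v v) $ i\<bar>)"
    unfolding euclid_norm_def by (simp add: L2_set_le_sum_abs del: index_mult_mat_vec)
  also have "\<dots> \<le> (\<Sum>i<dim_row A. \<Sum>j<dim_col A. \<bar>A $$ (i, j)\<bar>)"
  proof (rule sum_mono)
    fix i assume i: "i \<in> {..<dim_row A}"
    have "\<bar>(A *\<^sub>v v) $ i\<bar> = \<bar>\<Sum>j<dim_col A. A $$ (i, j) * v $ j\<bar>"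
      using i v by (subst mult_mat_vec_nth) auto
    also have "\<dots> \<le> (\<Sum>j<dim_col A. \<bar>A $$ (i, j) * v $ j\<bar>)" by (rule sum_abs)
    also have "\<dots> \<le> (\<Sum>j<dim_col A. \<bar>A $$ (i, j)\<bar>)"
    proof (rule sum_mono)
      fix j assume j: "j \<in> {..<dim_col A}"
      have "\<bar>v $ j\<bar> \<le> 1" using abs_vec_nth_le_euclid_norm[of j v] v j by auto
      then show "\<bar>A $$ (i, j) * v $ j\<bar> \<le> \<bar>A $$ (i, j)\<bar>"
        by (simp add: abs_mult mult_left_le)
    qed
    finally show "\<bar>(A *\<^sub>v v) $ i\<bar> \<le> (\<Sum>j<dim_col A. \<bar>A $$ (i, j)\<bar>)" .
  qed
  finally show "euclid_norm (A *\<^sub>v v) \<le> (\<Sum>i<dim_row A. \<Sum>j<dim_col A. \<bar>A $$ (i, j)\<bar>)" .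
qed

lemma euclid_norm_le_spectral_norm:
  "v \<in> carrier_vec (dim_col A) \<Longrightarrow> euclid_norm v \<le> 1 \<Longrightarrow> euclid_norm (A *\<^sub>v v) \<le> spectral_norm A"
  unfolding spectral_norm_def by (intro cSUP_upper bdd_above_spectral_norm) auto

lemma euclid_norm_zero [simp]: "euclid_norm (0\<^sub>v k) = 0"
  by (simp add: euclid_norm_def L2_set_def)

lemma spectral_norm_nonneg: "0 \<le> spectral_norm A"
  by (rule order_trans[OF _ euclid_norm_le_spectral_norm[of "0\<^sub>v (dim_col A)"]]) auto

text \<open>Normalise \<open>v\<close> and use homogeneity; a vector of norm 0 is the zero vector
  and is treated apart.\<close>

lemma euclid_norm_mult_le:
  assumes v: "v \<in> carrier_vec (dim_col A)"
  shows "euclid_norm (A *\<^sub>v v) \<le> spectral_norm A * euclid_norm v"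
proof (cases "euclid_norm v = 0")
  case True
  then have "v $ j = 0" if "j < dim_vec v" for j
    using abs_vec_nth_le_euclid_norm[OF that] by simp
  then have "v = 0\<^sub>v (dim_col A)" using v by auto
  then have "A *\<^sub>v v = 0\<^sub>v (dim_row A)" by auto
  then show ?thesis using True by simp
next
  case False
  then have pos: "0 < euclid_norm v" by (simp add: less_le)
  define w where "w = inverse (euclid_norm v) \<cdot>\<^sub>v v"
  have "euclid_norm (A *\<^sub>v w) \<le> spectral_norm A"
    using v pos by (intro euclid_norm_le_spectral_norm) (auto simp: w_def euclid_norm_smult)
  moreover have "A *\<^sub>v w = inverse (euclid_norm v) \<cdot>\<^sub>v (A *\<^sub>v v)"
    unfolding w_def using v by (intro mult_mat_vec) auto
  ultimately show ?thesis using pos by (simp add: euclid_norm_smult field_simps)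
qed

text \<open>Rational vectors are dense and both sides are continuous in the vector. This reduces the
  bound to countably many conditions, as measurability requires. In the homogeneous form,
  approximants of a vector in the unit ball may leave the ball.\<close>

lemma spectral_norm_le_iff_rational:
  assumes A: "A \<in> carrier_mat n m" and "0 \<le> a"
  shows "spectral_norm A \<le> a \<longleftrightarrow>
    (\<forall>q\<in>PiE {..<m} (\<lambda>_. \<rat>). euclid_norm (A *\<^sub>v vec m q) \<le> a * euclid_norm (vec m q))"
proof safe
  fix q :: "nat \<Rightarrow> real" assume le: "spectral_norm A \<le> a"
  have "euclid_norm (A *\<^sub>v vec m q) \<le> spectral_norm A * euclid_norm (vec m q)"
    using A by (intro euclid_norm_mult_le) auto
  also have "\<dots> \<le> a * euclid_norm (vec m q)" using le by (simp add: mult_right_mono)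
  finally show "euclid_norm (A *\<^sub>v vec m q) \<le> a * euclid_norm (vec m q)" .
next
  assume *: "\<forall>q\<in>PiE {..<m} (\<lambda>_. \<rat>). euclid_norm (A *\<^sub>v vec m q) \<le> a * euclid_norm (vec m q)"
  have cols: "dim_col A = m" "dim_row A = n" using A by auto
  show "spectral_norm A \<le> a" unfolding spectral_norm_def
  proof (rule cSUP_least)
    show "{v \<in> carrier_vec (dim_col A). euclid_norm v \<le> 1} \<noteq> {}"
      by (auto intro!: exI[of _ "0\<^sub>v (dim_col A)"])
  next
    fix v assume "v \<in> {v \<in> carrier_vec (dim_col A). euclid_norm v \<le> 1}"
    then have v: "v \<in> carrier_vec m" "euclid_norm v \<le> 1" by (auto simp: cols)
    have "\<exists>f. (\<forall>k. f k \<in> \<rat>) \<and> f \<longlonglongrightarrow> v $ j" for j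
      using Rats_closure_real closure_sequential[of "v $ j" \<rat>] by blast
    then obtain f where f: "\<And>j k. f j k \<in> \<rat>" "\<And>j. f j \<longlonglongrightarrow> v $ j" by metis
    \<comment> \<open>Restriction to \<open>{..<m}\<close> puts \<open>q k\<close> into the
      extensional product, which is countable.\<close>
    define q where "q k = (\<lambda>j\<in>{..<m}. f j k)" for k
    have q: "q k \<in> PiE {..<m} (\<lambda>_. \<rat>)" for k using f(1) by (auto simp: q_def)
    have lim1: "(\<lambda>k. euclid_norm (vec m (q k))) \<longlonglongrightarrow> euclid_norm v"
      using v(1) unfolding euclid_norm_def L2_set_def
      by (auto simp: q_def intro!: tendsto_intros f(2))
    have lim2: "(\<lambda>k. euclid_norm (A *\<^sub>v vec m (q k))) \<longlonglongrightarrow> euclid_norm (A *\<^sub>v v)"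
    proof -
      have "(\<lambda>k. sqrt (\<Sum>i<n. (\<Sum>j<m. A $$ (i, j) * f j k)\<^sup>2)) \<longlonglongrightarrow> sqrt (\<Sum>i<n. (\<Sum>j<m. A $$ (i, j) * v $ j)\<^sup>2)"
        by (intro tendsto_intros f(2))
      then show ?thesis using v(1) unfolding euclid_norm_def L2_set_def
        by (simp add: cols mult_mat_vec_nth q_def del: index_mult_mat_vec)
    qed
    have "euclid_norm (A *\<^sub>v v) \<le> a * euclid_norm v"
      by (rule LIMSEQ_le[OF lim2 tendsto_mult[OF tendsto_const lim1]]) (use * q in auto)
    also have "\<dots> \<le> a" using v(2) assms(2) by (simp add: mult_left_le)
    finally show "euclid_norm (A *\<^sub>v v) \<le> a" .
  qed
qed

text \<open>Each sublevel set is a countable intersection of sets given by inequalities that are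
  measurable in the entries. This makes the event of a large loss measurable.\<close>

lemma borel_measurable_spectral_norm:
  fixes A :: "'a \<Rightarrow> real mat"
  assumes A: "\<And>y. A y \<in> carrier_mat n m"
    and [measurable]: "\<And>i j. i < n \<Longrightarrow> j < m \<Longrightarrow> (\<lambda>y. A y $$ (i, j)) \<in> borel_measurable M"
  shows "(\<lambda>y. spectral_norm (A y)) \<in> borel_measurable M"
proof (subst borel_measurable_iff_le, rule allI)
  fix a :: real
  show "{y \<in> space M. spectral_norm (A y) \<le> a} \<in> sets M"
  proof (cases "0 \<le> a")
    case False
    then have "\<not> spectral_norm (A y) \<le> a" for y
      using spectral_norm_nonneg[of "A y"] by linarith
    then show ?thesis by simp
  next
    case True
    have count: "countable (PiE {..<m} (\<lambda>_. \<rat>::real set))"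
      by (intro countable_PiE) (auto simp: countable_rat)
    have dim: "dim_row (A y) = n" "dim_col (A y) = m" for y using A[of y] by auto
    have norm: "euclid_norm (A y *\<^sub>v vec m q) = sqrt (\<Sum>i<n. (\<Sum>j<m. A y $$ (i, j) * q j)\<^sup>2)" for y q
      unfolding euclid_norm_def L2_set_def
      by (simp add: dim mult_mat_vec_nth del: index_mult_mat_vec)
    have "{y \<in> space M. euclid_norm (A y *\<^sub>v vec m q) \<le> a * euclid_norm (vec m q)} \<in> sets M" for q
      unfolding norm by measurable
    then show ?thesis
      unfolding spectral_norm_le_iff_rational[OF A True]
      by (intro sets.sets_Collect_countable_All' count)
  qed
qed

text \<open>Column \<open>j\<close> is the image of a unit vector, which has norm 1.\<close>

lemma sum_col_le_spectral_norm:
  assumes "A \<in> carrier_mat n m" "j < m"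
  shows "(\<Sum>i<n. (A $$ (i, j))\<^sup>2) \<le> (spectral_norm A)\<^sup>2"
proof -
  have dim: "dim_row A = n" "dim_col A = m" using assms by auto
  have e: "euclid_norm (unit_vec m j) = 1"
    using assms(2) by (simp add: euclid_norm_def L2_set_def unit_vec_def if_distrib[of "\<lambda>x. x\<^sup>2"] cong: if_cong)
  have "(\<Sum>i<n. (A $$ (i, j))\<^sup>2) = (euclid_norm (A *\<^sub>v unit_vec m j))\<^sup>2"
    using assms unfolding euclid_norm_def L2_set_def
    by (simp add: dim sum_nonneg mult_mat_unit_vec[of A n m])
  also have "\<dots> \<le> (spectral_norm A)\<^sup>2"
    using euclid_norm_mult_le[of "unit_vec m j" A] by (intro power_mono) (auto simp: dim e)
  finally show ?thesis .
qed

text \<open>Apply \<open>A\<close> to its own row \<open>r\<close>. Coordinate \<open>i\<close> of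
  \<open>A *\<^sub>v r\<close> is the squared norm of \<open>r\<close>, and it is at most
  \<open>spectral_norm A * euclid_norm r\<close>; cancel one factor
  \<open>euclid_norm r\<close>.\<close>

lemma sum_row_le_spectral_norm:
  assumes "A \<in> carrier_mat n m" "i < n"
  shows "(\<Sum>j<m. (A $$ (i, j))\<^sup>2) \<le> (spectral_norm A)\<^sup>2"
proof -
  have dim: "dim_row A = n" "dim_col A = m" using assms by auto
  define r where "r = row A i"
  have r: "r \<in> carrier_vec m" by (simp add: r_def row_carrier_vec dim assms(2) carrier_vecI)
  have "(\<Sum>j<m. (A $$ (i, j))\<^sup>2) = (euclid_norm r)\<^sup>2"
    using assms by (simp add: r_def euclid_norm_def L2_set_def sum_nonneg dim)
  moreover have "(euclid_norm r)\<^sup>2 \<le> euclid_norm (A *\<^sub>v r)"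
  proof -
    have "(A *\<^sub>v r) $ i = (\<Sum>j<m. (A $$ (i, j))\<^sup>2)"
      using assms by (subst mult_mat_vec_nth) (auto simp: dim r_def power2_eq_square)
    then show ?thesis
      using abs_vec_nth_le_euclid_norm[of i "A *\<^sub>v r"] assms calculation by (simp add: dim del: index_mult_mat_vec)
  qed
  moreover have "euclid_norm (A *\<^sub>v r) \<le> spectral_norm A * euclid_norm r"
    using r by (intro euclid_norm_mult_le) (simp add: dim)
  ultimately have "euclid_norm r * euclid_norm r \<le> spectral_norm A * euclid_norm r"
    by (simp add: power2_eq_square)
  then have "euclid_norm r \<le> spectral_norm A"
    using spectral_norm_nonneg[of A] euclid_norm_nonneg[of r]
    by (cases "euclid_norm r = 0") (auto simp: less_le)
  then show ?thesis using \<open>_ = (euclid_norm r)\<^sup>2\<close> by (simp add: power_mono)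
qed

section \<open>Rank-one 0-1 patterns in the structured class\<close>

text \<open>For \<open>s = 0\<close> the identity acts on \<open>x\<close> itself. Otherwise put
  \<open>x\<close> into the first column of \<open>X\<close> and zeros elsewhere, so that every row
  has at most one non-zero entry, and let \<open>u\<close> be the first unit vector.\<close>

lemma sparse_class_action:
  fixes x :: "nat \<Rightarrow> real"
  assumes "1 \<le> k" "s = 0 \<longrightarrow> k = n" "{0, 1} \<subseteq> D" "\<And>i. x i \<in> {0, 1}"
  obtains X u where "X \<in> sparse_class n k s D" "X \<in> carrier_mat n k" "u \<in> carrier_vec k"
    "X *\<^sub>v u = vec n x"
proof (cases "s = 0")
  case True
  show ?thesis
    by (rule that[of "1\<^sub>m n" "vec n x"]) (use True assms in \<open>auto simp: sparse_class_def\<close>)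
next
  case False
  define X where "X = mat n k (\<lambda>(i, j). if j = 0 then x i else 0)"
  have "l0_norm (row X i) \<le> s" if "i < n" for i
  proof -
    have "{j. j < dim_vec (row X i) \<and> row X i $ j \<noteq> 0} \<subseteq> {0}"
      using that by (auto simp: X_def split: if_splits)
    then have "l0_norm (row X i) \<le> card {0::nat}"
      unfolding l0_norm_def by (intro card_mono) auto
    then show ?thesis using False by simp
  qed
  moreover have "elements_mat X \<subseteq> D"
  proof -
    have "x i \<in> D" for i using assms(3) assms(4)[of i] by auto
    then show ?thesis using assms(3) by (auto simp: X_def dest!: elements_matD)
  qed
  ultimately have "X \<in> sparse_class n k s D"
    using False by (simp add: sparse_class_def X_def)
  moreover have "X *\<^sub>v unit_vec k 0 = vec n x"
    using assms(1) by (subst mult_mat_unit_vec[of _ n k]) (auto simp: X_def)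
  ultimately show ?thesis
    by (intro that[of X "unit_vec k 0"]) (auto simp: X_def)
qed

text \<open>If \<open>X\<close> maps \<open>u\<close> to \<open>x\<close> and \<open>Z\<close> maps
  \<open>w\<close> to \<open>z\<close>, then the middle factor \<open>B\<close>, equal to
  \<open>b\<close> times the outer product of \<open>u\<close> and \<open>w\<close>, yields
  \<open>b\<close> times the outer product of \<open>x\<close> and \<open>z\<close>.\<close>

lemma rank_one_in_structured_class:
  fixes x z :: "nat \<Rightarrow> real"
  assumes "1 \<le> k\<^sub>n" "s\<^sub>n = 0 \<longrightarrow> k\<^sub>n = n" "{0, 1} \<subseteq> D\<^sub>n" "\<And>i. x i \<in> {0, 1}"
    and "1 \<le> k\<^sub>m" "s\<^sub>m = 0 \<longrightarrow> k\<^sub>m = m" "{0, 1} \<subseteq> D\<^sub>m" "\<And>j. z j \<in> {0, 1}"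
  shows "mat n m (\<lambda>(i, j). b * x i * z j) \<in> structured_class n m k\<^sub>n k\<^sub>m s\<^sub>n s\<^sub>m D\<^sub>n D\<^sub>m"
proof -
  obtain X u where X: "X \<in> sparse_class n k\<^sub>n s\<^sub>n D\<^sub>n" "X \<in> carrier_mat n k\<^sub>n"
      "u \<in> carrier_vec k\<^sub>n" "X *\<^sub>v u = vec n x"
    by (rule sparse_class_action[OF assms(1-4)])
  obtain Z w where Z: "Z \<in> sparse_class m k\<^sub>m s\<^sub>m D\<^sub>m" "Z \<in> carrier_mat m k\<^sub>m"
      "w \<in> carrier_vec k\<^sub>m" "Z *\<^sub>v w = vec m z"
    by (rule sparse_class_action[OF assms(5-8)])
  define B where "B = mat k\<^sub>n k\<^sub>m (\<lambda>(i, j). b * u $ i * w $ j)"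
  have x: "(\<Sum>l<k\<^sub>n. X $$ (i, l) * u $ l) = x i" if "i < n" for i
  proof -
    have "(X *\<^sub>v u) $ i = (\<Sum>l<k\<^sub>n. X $$ (i, l) * u $ l)"
      using X that by (subst mult_mat_vec_nth) auto
    then show ?thesis using X that by simp
  qed
  have z: "(\<Sum>l<k\<^sub>m. Z $$ (j, l) * w $ l) = z j" if "j < m" for j
  proof -
    have "(Z *\<^sub>v w) $ j = (\<Sum>l<k\<^sub>m. Z $$ (j, l) * w $ l)"
      using Z that by (subst mult_mat_vec_nth) auto
    then show ?thesis using Z that by simp
  qed
  have "mat n m (\<lambda>(i, j). b * x i * z j) = X * B * Z\<^sup>T"
  proof (rule eq_matI)
    fix i j assume "i < dim_row (X * B * Z\<^sup>T)" "j < dim_col (X * B * Z\<^sup>T)"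
    then have ij: "i < n" "j < m" using X Z by auto
    have "(X * B * Z\<^sup>T) $$ (i, j) = (\<Sum>l<k\<^sub>m. (\<Sum>r<k\<^sub>n. X $$ (i, r) * (b * u $ r * w $ l)) * Z $$ (j, l))"
      using ij X(2) Z(2) by (simp add: B_def scalar_prod_def atLeast0LessThan)
    also have "\<dots> = (\<Sum>l<k\<^sub>m. b * x i * (Z $$ (j, l) * w $ l))"
      unfolding x[OF ij(1), symmetric]
      by (simp add: sum_distrib_left sum_distrib_right mult_ac)
    also have "\<dots> = b * x i * z j"
      by (simp add: sum_distrib_left[symmetric] z[OF ij(2)])
    finally show "mat n m (\<lambda>(i, j). b * x i * z j) $$ (i, j) = (X * B * Z\<^sup>T) $$ (i, j)"
      using ij by simp
  qed (use X Z in auto)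
  then show ?thesis
    unfolding structured_class_def using X Z by (auto simp: B_def intro!: exI)
qed

section \<open>Averaging over bit patterns\<close>

lemma sum_Pow_remove:
  fixes f :: "'a set \<Rightarrow> real"
  assumes "finite J" "j \<in> J"
  shows "(\<Sum>S\<in>Pow J. f S) = (\<Sum>S\<in>Pow (J - {j}). f S + f (insert j S))"
proof -
  define K where "K = J - {j}"
  have J: "J = insert j K" "j \<notin> K" "finite K" using assms by (auto simp: K_def)
  have "inj_on (insert j) (Pow K)" using J(2) by (auto simp: inj_on_def)
  moreover have "Pow K \<inter> insert j ` Pow K = {}" using J(2) by auto
  ultimately show ?thesis
    using J(3) by (simp add: K_def[symmetric]) (simp add: J(1) Pow_insert sum.union_disjoint sum.reindex sum.distrib)
qed

text \<open>\<open>A j\<close> is the event that a test declares bit \<open>j\<close> to be 0. Pair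
  each \<open>S\<close> without \<open>j\<close> with \<open>insert j S\<close>: the two error
  probabilities for bit \<open>j\<close> add up to at least \<open>1 - \<epsilon>\<close>. Hence
  each bit has average error at least \<open>(1 - \<epsilon>) / 2\<close> over all patterns, and
  some pattern reaches the average of the summed errors.\<close>

lemma assouad:
  fixes P :: "'a set \<Rightarrow> 'b measure"
  assumes "finite J"
    and P: "\<And>S. S \<subseteq> J \<Longrightarrow> prob_space (P S)" "\<And>S. S \<subseteq> J \<Longrightarrow> sets (P S) = sets M"
    and A: "\<And>j. j \<in> J \<Longrightarrow> A j \<in> sets M"
    and le: "\<And>j S. j \<in> J \<Longrightarrow> S \<subseteq> J - {j} \<Longrightarrow>
      measure (P S) (A j) \<le> measure (P (insert j S)) (A j) + \<epsilon>"
  obtains S where "S \<subseteq> J"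
    "(1 - \<epsilon>) / 2 * card J \<le> (\<Sum>j\<in>J. measure (P S) (if j \<in> S then A j else space M - A j))"
proof -
  define err where "err S j = measure (P S) (if j \<in> S then A j else space M - A j)" for S j
  have pair: "1 - \<epsilon> \<le> err S j + err (insert j S) j" if "j \<in> J" "S \<in> Pow (J - {j})" for S j
  proof -
    have S: "S \<subseteq> J" "j \<notin> S" using that by auto
    interpret prob_space "P S" using P(1)[OF S(1)] .
    have "err S j = 1 - measure (P S) (A j)"
      using S P(2)[OF S(1)] sets_eq_imp_space_eq[OF P(2)[OF S(1)]] A[OF that(1)] prob_compl[of "A j"]
      by (simp add: err_def)
    then show ?thesis using le[OF that(1), of S] that(2) by (simp add: err_def)
  qed
  have "(\<Sum>S\<in>Pow J. (1 - \<epsilon>) / 2 * card J) = (\<Sum>j\<in>J. (1 - \<epsilon>) * real (card (Pow J)) / 2)"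
    by simp
  also have "\<dots> \<le> (\<Sum>j\<in>J. \<Sum>S\<in>Pow J. err S j)"
  proof (rule sum_mono)
    fix j assume j: "j \<in> J"
    \<comment> \<open>Exactly half of the patterns omit \<open>j\<close>, which is the source of the
      factor \<open>1 / 2\<close>.\<close>
    have "card (Pow J) = 2 * card (Pow (J - {j}))"
      using card.remove[OF \<open>finite J\<close> j] \<open>finite J\<close> by (simp add: card_Pow)
    then have "(1 - \<epsilon>) * real (card (Pow J)) / 2 = (\<Sum>S\<in>Pow (J - {j}). 1 - \<epsilon>)"
      by simp
    also have "\<dots> \<le> (\<Sum>S\<in>Pow (J - {j}). err S j + err (insert j S) j)"
      by (intro sum_mono pair j)
    also have "\<dots> = (\<Sum>S\<in>Pow J. err S j)"
      using sum_Pow_remove[OF \<open>finite J\<close> j, of "\<lambda>S. err S j"] by simp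
    finally show "(1 - \<epsilon>) * real (card (Pow J)) / 2 \<le> (\<Sum>S\<in>Pow J. err S j)" .
  qed
  also have "\<dots> = (\<Sum>S\<in>Pow J. \<Sum>j\<in>J. err S j)" by (rule sum.swap)
  finally have "(\<Sum>S\<in>Pow J. (1 - \<epsilon>) / 2 * card J) \<le> (\<Sum>S\<in>Pow J. \<Sum>j\<in>J. err S j)" .
  \<comment> \<open>If every pattern stayed strictly below the average, so would the total.\<close>
  then obtain S where "S \<in> Pow J" "(1 - \<epsilon>) / 2 * card J \<le> (\<Sum>j\<in>J. err S j)"
    using \<open>finite J\<close> sum_strict_mono[of "Pow J" "\<lambda>S. \<Sum>j\<in>J. err S j" "\<lambda>S. (1 - \<epsilon>) / 2 * card J"]
    by (metis Pow_not_empty finite_Pow_iff not_le)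
  then show ?thesis by (intro that[of S]) (auto simp: err_def)
qed

section \<open>Lower bounds for a single estimator\<close>

text \<open>\<open>J\<close> is a row or a column of the matrix. A hypothesis is a subset \<open>S\<close> of \<open>J\<close>, and an estimator
  misclassifies an entry of \<open>J\<close> when thresholding it at \<open>b / 2\<close> gives the wrong answer.\<close>

lemma minimax_over_line:
  fixes \<delta> :: "(nat \<times> nat \<Rightarrow> real) \<Rightarrow> real mat"
  assumes \<delta>: "\<delta> \<in> estimators n m" and p: "0 < p" "p \<le> 1" and \<sigma>: "0 < \<sigma>"
    and J: "J \<subseteq> index_set n m" "J \<noteq> {}"
    and spec: "\<And>A. A \<in> carrier_mat n m \<Longrightarrow> (\<Sum>ij\<in>J. (A $$ ij)\<^sup>2) \<le> (spectral_norm A)\<^sup>2"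
    and \<Theta>: "\<And>b S. S \<subseteq> J \<Longrightarrow> mat n m (\<lambda>ij. b * of_bool (ij \<in> S)) \<in> \<Theta>"
  defines "r \<equiv> 1 / 256 * \<sigma>\<^sup>2 / p * real (card J)"
  obtains \<theta> where "\<theta> \<in> \<Theta>"
    "0.1 \<le> \<P>(y in law_Y n m p \<sigma> \<theta>. (spectral_norm (\<delta> y - \<theta>))\<^sup>2 \<ge> r)"
    "ennreal r \<le> (\<integral>\<^sup>+y. ennreal ((spectral_norm (\<delta> y - \<theta>))\<^sup>2) \<partial>law_Y n m p \<sigma> \<theta>)"
proof -
  \<comment> \<open>This size makes \<open>p * (b / \<sigma>)\<close> equal to
    \<open>sqrt p / 4\<close>, so the laws of neighbouring hypotheses stay close, while
    \<open>b\<^sup>2\<close> still has the order \<open>\<sigma>\<^sup>2 / p\<close> of the claimed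
    rate.\<close>
  define b where "b = \<sigma> / (4 * sqrt p)"
  have b: "0 < b" using p \<sigma> by (simp add: b_def)
  have b2: "b\<^sup>2 = \<sigma>\<^sup>2 / (16 * p)" using p by (simp add: b_def power_divide power_mult_distrib)
  have pb: "p * (b / \<sigma>) \<le> 1 / 4"
  proof -
    have "p * (b / \<sigma>) = sqrt p * sqrt p / (4 * sqrt p)" using p \<sigma> by (simp add: b_def)
    also have "\<dots> = sqrt p / 4" using p by (simp del: real_sqrt_mult_self)
    also have "\<dots> \<le> 1 / 4" using p by simp
    finally show ?thesis .
  qed
  define \<theta> where "\<theta> S = mat n m (\<lambda>ij. b * of_bool (ij \<in> S))" for S
  have \<theta>_nth: "\<theta> S $$ ij = b * of_bool (ij \<in> S)" if "ij \<in> index_set n m" for S ij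
    using that by (auto simp: \<theta>_def)
  have finJ: "finite J" using J(1) by (rule finite_subset) simp
  define P where "P S = law_Y n m p \<sigma> (\<theta> S)" for S
  have P: "prob_space (P S)" "sets (P S) = sets (obs_space n m)" for S
    using prob_space_law_Y[OF \<sigma>] by (simp_all add: P_def law_Y_def)
  note [measurable_cong] = P(2)
  have space_P: "space (P S) = space (obs_space n m)" for S
    using P(2) by (rule sets_eq_imp_space_eq)
  have \<delta>m: "\<delta> y \<in> carrier_mat n m" for y using \<delta> by (simp add: estimators_def)
  have \<delta>meas: "(\<lambda>y. \<delta> y $$ ij) \<in> borel_measurable (obs_space n m)" if "ij \<in> index_set n m" for ij
    using \<delta> that by (cases ij) (simp add: estimators_def)
  \<comment> \<open>The event that thresholding reads the entry as 0; a tie at \<open>b / 2\<close>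
    counts as 0.\<close>
  define A where "A ij = {y \<in> space (obs_space n m). \<delta> y $$ ij \<le> b / 2}" for ij
  have A: "A ij \<in> sets (obs_space n m)" if "ij \<in> J" for ij
  proof -
    note [measurable] = \<delta>meas[OF subsetD[OF J(1) that]]
    show ?thesis unfolding A_def by measurable
  qed
  have le: "measure (P S) (A j) \<le> measure (P (insert j S)) (A j) + 1 / 4"
    if "j \<in> J" "S \<subseteq> J - {j}" for j S
  proof -
    interpret P: prob_space "P S" by (rule P)
    interpret P': prob_space "P (insert j S)" by (rule P)
    have "emeasure (P S) (A j) \<le> emeasure (P (insert j S)) (A j) + ennreal (p * (b / \<sigma>))"
      unfolding P_def
    proof (rule law_Y_flip_le)
      show "j \<in> index_set n m" using J(1) that by auto
      then show "\<theta> (insert j S) $$ j = \<theta> S $$ j + b"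
        using that by (auto simp: \<theta>_nth)
    qed (use b p \<sigma> A that in \<open>auto simp: \<theta>_nth\<close>)
    also have "\<dots> \<le> emeasure (P (insert j S)) (A j) + ennreal (1 / 4)"
      using pb by (intro add_left_mono ennreal_leI)
    finally show ?thesis
      by (simp add: P.emeasure_eq_measure P'.emeasure_eq_measure ennreal_plus[symmetric] del: ennreal_plus)
  qed
  obtain S where S: "S \<subseteq> J" and S_err:
    "(1 - 1 / 4) / 2 * card J \<le> (\<Sum>j\<in>J. measure (P S) (if j \<in> S then A j else space (obs_space n m) - A j))"
    by (rule assouad[of J P "obs_space n m" A "1 / 4"]) (use finJ P A le in auto)
  define Err where "Err j = (if j \<in> S then A j else space (obs_space n m) - A j)" for j
  have err: "3 / 8 * card J \<le> (\<Sum>j\<in>J. measure (P S) (Err j))"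
    using S_err by (simp add: Err_def)
  have Err [measurable]: "Err j \<in> sets (obs_space n m)" if "j \<in> J" for j
    using A[OF that] by (simp add: Err_def)
  interpret P: prob_space "P S" by (rule P)
  define N where "N y = (\<Sum>j\<in>J. indicator (Err j) y :: real)" for y
  have N_int: "integrable (P S) N" "(\<integral>y. N y \<partial>P S) = (\<Sum>j\<in>J. measure (P S) (Err j))"
  proof -
    have int: "integrable (P S) (indicator (Err j) :: _ \<Rightarrow> real)" if "j \<in> J" for j
      using Err[OF that] by (intro integrable_real_indicator) (auto simp: P.emeasure_eq_measure P(2))
    then show "integrable (P S) N" unfolding N_def by (intro Bochner_Integration.integrable_sum)
    show "(\<integral>y. N y \<partial>P S) = (\<Sum>j\<in>J. measure (P S) (Err j))"
      unfolding N_def using int Err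
      by (subst Bochner_Integration.integral_sum)
         (auto intro!: sum.cong simp: P(2) space_P dest: sets.sets_into_space)
  qed
  have N_bounds: "0 \<le> N y" "N y \<le> card J" for y
  proof -
    show "0 \<le> N y" by (auto simp: N_def intro: sum_nonneg)
    have "N y \<le> (\<Sum>j\<in>J. 1)" unfolding N_def by (intro sum_mono) (auto simp: indicator_def)
    then show "N y \<le> card J" by simp
  qed
  \<comment> \<open>A misclassified entry is off by at least \<open>b / 2\<close>, since the
    threshold lies midway between 0 and \<open>b\<close>; by \<open>spec\<close> the spectral norm
    controls the sum of these squared errors.\<close>
  have loss: "b\<^sup>2 / 4 * N y \<le> (spectral_norm (\<delta> y - \<theta> S))\<^sup>2" if y: "y \<in> space (P S)" for y
  proof -
    have "b\<^sup>2 / 4 * N y = (\<Sum>j\<in>J. b\<^sup>2 / 4 * indicator (Err j) y)"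
      by (simp add: N_def sum_distrib_left)
    also have "\<dots> \<le> (\<Sum>j\<in>J. ((\<delta> y - \<theta> S) $$ j)\<^sup>2)"
    proof (rule sum_mono)
      fix j assume "j \<in> J"
      then have j: "j \<in> index_set n m" using J by auto
      have diff: "(\<delta> y - \<theta> S) $$ j = \<delta> y $$ j - b * of_bool (j \<in> S)"
        using j \<delta>m[of y] by (cases j) (auto simp: \<theta>_def)
      have "b / 2 \<le> \<bar>(\<delta> y - \<theta> S) $$ j\<bar>" if "y \<in> Err j"
      proof (cases "j \<in> S")
        case True
        then have "\<delta> y $$ j \<le> b / 2" using that by (simp add: Err_def A_def)
        then have "b / 2 \<le> \<bar>\<delta> y $$ j - b\<bar>" using b by linarith
        then show ?thesis using True unfolding diff by simp
      next
        case False
        then have "b / 2 < \<delta> y $$ j" using that by (simp add: Err_def A_def not_le)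
        then show ?thesis using False unfolding diff by simp
      qed
      then have "(b / 2)\<^sup>2 \<le> ((\<delta> y - \<theta> S) $$ j)\<^sup>2" if "y \<in> Err j"
        using that b by (subst power2_abs[symmetric]) (intro power_mono, auto)
      then show "b\<^sup>2 / 4 * indicator (Err j) y \<le> ((\<delta> y - \<theta> S) $$ j)\<^sup>2"
        by (auto simp: indicator_def power_divide)
    qed
    also have "\<dots> \<le> (spectral_norm (\<delta> y - \<theta> S))\<^sup>2"
      by (rule spec) (auto simp: \<theta>_def)
    finally show ?thesis .
  qed
  have cJ: "0 < real (card J)" using J(2) finJ by (simp add: card_gt_0_iff)
  \<comment> \<open>\<open>r\<close> is the loss guaranteed when a quarter of the bits are wrong;
    with \<open>b\<^sup>2 = \<sigma>\<^sup>2 / (16 * p)\<close> this gives the constant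
    \<open>1 / 256\<close>.\<close>
  have r: "r = b\<^sup>2 / 4 * (card J / 4)" by (simp add: r_def b2)
  define G where "G = {y \<in> space (P S). r \<le> (spectral_norm (\<delta> y - \<theta> S))\<^sup>2}"
  have [measurable]: "(\<lambda>y. spectral_norm (\<delta> y - \<theta> S)) \<in> borel_measurable (obs_space n m)"
  proof (rule borel_measurable_spectral_norm)
    show "\<delta> y - \<theta> S \<in> carrier_mat n m" for y by (auto simp: \<theta>_def)
    fix i j assume ij: "i < n" "j < m"
    have "(\<lambda>y. \<delta> y $$ (i, j) - \<theta> S $$ (i, j)) \<in> borel_measurable (obs_space n m)"
      using \<delta>meas[of "(i, j)"] ij by simp
    then show "(\<lambda>y. (\<delta> y - \<theta> S) $$ (i, j)) \<in> borel_measurable (obs_space n m)"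
      using ij by (simp add: \<theta>_def)
  qed
  have G: "G \<in> sets (P S)" unfolding G_def by measurable
  have "3 / 8 * card J \<le> (\<integral>y. N y \<partial>P S)" using err N_int by simp
  \<comment> \<open>A reverse Markov inequality: outside \<open>G\<close> the loss is below
    \<open>r\<close>, which forces fewer than a quarter of the bits to be wrong, and on
    \<open>G\<close> the trivial bound \<open>card J\<close> is used.\<close>
  also have "\<dots> \<le> (\<integral>y. card J / 4 + real (card J) * indicator G y \<partial>P S)"
  proof (rule integral_mono)
    show "integrable (P S) (\<lambda>y. card J / 4 + real (card J) * indicator G y)"
      using G by (intro Bochner_Integration.integrable_add integrable_mult_right integrable_real_indicator)
        (auto simp: P.emeasure_eq_measure)
    fix y assume y: "y \<in> space (P S)"
    show "N y \<le> card J / 4 + real (card J) * indicator G y"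
    proof (cases "y \<in> G")
      case False
      then have "\<not> r \<le> (spectral_norm (\<delta> y - \<theta> S))\<^sup>2" using y by (simp add: G_def)
      then have "b\<^sup>2 / 4 * N y < b\<^sup>2 / 4 * (card J / 4)"
        using loss[OF y] unfolding r by linarith
      then have "N y < card J / 4" using b by (subst (asm) mult_less_cancel_left_pos) auto
      then show ?thesis using False by simp
    qed (use N_bounds(2)[of y] in simp)
  qed (rule N_int)
  also have "\<dots> = card J / 4 + card J * measure (P S) G"
  proof -
    have "integrable (P S) (indicator G :: _ \<Rightarrow> real)"
      using G by (intro integrable_real_indicator) (auto simp: P.emeasure_eq_measure)
    then show ?thesis using G by (simp add: P.prob_space)
  qed
  \<comment> \<open>The margin is \<open>3 / 8 - 1 / 4 = 1 / 8\<close>, which exceeds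
    \<open>0.1\<close>.\<close>
  finally have "card J * (1 / 8) \<le> card J * measure (P S) G" by simp
  then have "1 / 8 \<le> measure (P S) G" using cJ by (subst (asm) mult_le_cancel_left_pos) auto
  then have prob: "0.1 \<le> \<P>(y in P S. (spectral_norm (\<delta> y - \<theta> S))\<^sup>2 \<ge> r)" by (simp add: G_def)
  \<comment> \<open>The bound in expectation follows from \<open>loss\<close> directly, as the mean
    number of wrong bits is at least \<open>3 / 8 * card J\<close>, hence at least
    \<open>card J / 4\<close>.\<close>
  have "r \<le> b\<^sup>2 / 4 * (\<integral>y. N y \<partial>P S)"
    unfolding r using err N_int cJ by (intro mult_left_mono) auto
  then have "ennreal r \<le> ennreal (\<integral>y. b\<^sup>2 / 4 * N y \<partial>P S)"
    by (simp add: ennreal_leI)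
  also have "\<dots> = (\<integral>\<^sup>+y. ennreal (b\<^sup>2 / 4 * N y) \<partial>P S)"
    using N_int(1) N_bounds(1) by (intro nn_integral_eq_integral[symmetric]) auto
  also have "\<dots> \<le> (\<integral>\<^sup>+y. ennreal ((spectral_norm (\<delta> y - \<theta> S))\<^sup>2) \<partial>P S)"
    by (intro nn_integral_mono ennreal_leI loss)
  finally show ?thesis
    using prob by (intro that[of "\<theta> S"]) (auto simp: \<theta>_def P_def intro!: \<Theta> S)
qed

section \<open>Choice of the line and conclusion\<close>

text \<open>Take the first column if \<open>m \<le> n\<close> and the first row otherwise. A 0-1
  pattern on it is an outer product of a 0-1 vector and a first unit vector, hence of the rank-one
  form above.\<close>

lemma exists_line:
  fixes n m :: nat
  assumes "1 \<le> n" "1 \<le> m"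
    and "1 \<le> k\<^sub>n" "s\<^sub>n = 0 \<longrightarrow> k\<^sub>n = n" "{0, 1} \<subseteq> D\<^sub>n"
    and "1 \<le> k\<^sub>m" "s\<^sub>m = 0 \<longrightarrow> k\<^sub>m = m" "{0, 1} \<subseteq> D\<^sub>m"
  obtains J where "J \<subseteq> index_set n m" "card J = max n m"
    "\<And>A. A \<in> carrier_mat n m \<Longrightarrow> (\<Sum>ij\<in>J. (A $$ ij)\<^sup>2) \<le> (spectral_norm A)\<^sup>2"
    "\<And>b S. S \<subseteq> J \<Longrightarrow> mat n m (\<lambda>ij. b * of_bool (ij \<in> S)) \<in> structured_class n m k\<^sub>n k\<^sub>m s\<^sub>n s\<^sub>m D\<^sub>n D\<^sub>m"
proof (cases "m \<le> n")
  case True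
  show ?thesis
  proof (rule that[of "{..<n} \<times> {0}"])
    fix A :: "real mat" assume A: "A \<in> carrier_mat n m"
    have "(\<Sum>ij\<in>{..<n} \<times> {0}. (A $$ ij)\<^sup>2) = (\<Sum>i<n. (A $$ (i, 0))\<^sup>2)"
      by (rule sum.reindex_bij_witness[of _ "\<lambda>i. (i, 0)" fst]) auto
    then show "(\<Sum>ij\<in>{..<n} \<times> {0}. (A $$ ij)\<^sup>2) \<le> (spectral_norm A)\<^sup>2"
      using sum_col_le_spectral_norm[OF A, of 0] assms(2) by simp
  next
    fix b :: real and S assume S: "S \<subseteq> {..<n} \<times> {0::nat}"
    have "mat n m (\<lambda>ij. b * of_bool (ij \<in> S)) = mat n m (\<lambda>(i, j). b * of_bool ((i, 0) \<in> S) * of_bool (j = 0))"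
      using S by (intro eq_matI) (auto simp: of_bool_def)
    then show "mat n m (\<lambda>ij. b * of_bool (ij \<in> S)) \<in> structured_class n m k\<^sub>n k\<^sub>m s\<^sub>n s\<^sub>m D\<^sub>n D\<^sub>m"
      by (simp only:) (rule rank_one_in_structured_class[OF assms(3-5) _ assms(6-8)], auto)
  qed (use True assms in auto)
next
  case False
  show ?thesis
  proof (rule that[of "{0} \<times> {..<m}"])
    fix A :: "real mat" assume A: "A \<in> carrier_mat n m"
    have "(\<Sum>ij\<in>{0} \<times> {..<m}. (A $$ ij)\<^sup>2) = (\<Sum>j<m. (A $$ (0, j))\<^sup>2)"
      by (rule sum.reindex_bij_witness[of _ "\<lambda>j. (0, j)" snd]) auto
    then show "(\<Sum>ij\<in>{0} \<times> {..<m}. (A $$ ij)\<^sup>2) \<le> (spectral_norm A)\<^sup>2"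
      using sum_row_le_spectral_norm[OF A, of 0] assms(1) by simp
  next
    fix b :: real and S assume S: "S \<subseteq> {0::nat} \<times> {..<m}"
    have "mat n m (\<lambda>ij. b * of_bool (ij \<in> S)) = mat n m (\<lambda>(i, j). b * of_bool (i = 0) * of_bool ((0, j) \<in> S))"
      using S by (intro eq_matI) (auto simp: of_bool_def)
    then show "mat n m (\<lambda>ij. b * of_bool (ij \<in> S)) \<in> structured_class n m k\<^sub>n k\<^sub>m s\<^sub>n s\<^sub>m D\<^sub>n D\<^sub>m"
      by (simp only:) (rule rank_one_in_structured_class[OF assms(3-5) _ assms(6-8)], auto)
  qed (use False assms in auto)
qed

theorem corollary4:
  shows "\<exists>C'::real. C' > 0 \<and>
    (\<forall>(n::nat) (m::nat) (k\<^sub>n::nat) (k\<^sub>m::nat) (s\<^sub>n::nat) (s\<^sub>m::nat)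
        (D\<^sub>n::real set) (D\<^sub>m::real set) (p::real) (\<sigma>::real).
      1 \<le> n \<longrightarrow> 1 \<le> m \<longrightarrow> 1 \<le> k\<^sub>n \<longrightarrow> 1 \<le> k\<^sub>m \<longrightarrow> s\<^sub>n \<le> k\<^sub>n \<longrightarrow> s\<^sub>m \<le> k\<^sub>m \<longrightarrow>
      (s\<^sub>n = 0 \<longrightarrow> k\<^sub>n = n) \<longrightarrow> (s\<^sub>m = 0 \<longrightarrow> k\<^sub>m = m) \<longrightarrow>
      {0, 1} \<subseteq> D\<^sub>n \<longrightarrow> {0, 1} \<subseteq> D\<^sub>m \<longrightarrow> 0 < p \<longrightarrow> p \<le> 1 \<longrightarrow> 0 < \<sigma> \<longrightarrow>
      (INF \<delta>\<in>estimators n m. SUP \<theta>\<in>structured_class n m k\<^sub>n k\<^sub>m s\<^sub>n s\<^sub>m D\<^sub>n D\<^sub>m.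
         \<P>(y in law_Y n m p \<sigma> \<theta>.
            (spectral_norm (\<delta> y - \<theta>))\<^sup>2 \<ge> C' * \<sigma>\<^sup>2 / p * real (max n m))) \<ge> 0.1 \<and>
      (INF \<delta>\<in>estimators n m. SUP \<theta>\<in>structured_class n m k\<^sub>n k\<^sub>m s\<^sub>n s\<^sub>m D\<^sub>n D\<^sub>m.
         \<integral>\<^sup>+y. ennreal ((spectral_norm (\<delta> y - \<theta>))\<^sup>2) \<partial>law_Y n m p \<sigma> \<theta>)
        \<ge> ennreal (C' * \<sigma>\<^sup>2 / p * real (max n m)))"
\<comment> \<open>The constant is the one in the definition of \<open>r\<close> in
  \<open>minimax_over_line\<close>, and it serves both bounds.\<close>
proof (rule exI[of _ "1 / 256"], intro conjI allI impI)
  fix n m k\<^sub>n k\<^sub>m s\<^sub>n s\<^sub>m :: nat and D\<^sub>n D\<^sub>m :: "real set" and p \<sigma> :: real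
  assume h: "1 \<le> n" "1 \<le> m" "1 \<le> k\<^sub>n" "1 \<le> k\<^sub>m" "s\<^sub>n \<le> k\<^sub>n" "s\<^sub>m \<le> k\<^sub>m"
    "s\<^sub>n = 0 \<longrightarrow> k\<^sub>n = n" "s\<^sub>m = 0 \<longrightarrow> k\<^sub>m = m" "{0, 1} \<subseteq> D\<^sub>n" "{0, 1} \<subseteq> D\<^sub>m" "0 < p" "p \<le> 1" "0 < \<sigma>"
  let ?\<Theta> = "structured_class n m k\<^sub>n k\<^sub>m s\<^sub>n s\<^sub>m D\<^sub>n D\<^sub>m"
  let ?r = "1 / 256 * \<sigma>\<^sup>2 / p * real (max n m)"
  obtain J where J: "J \<subseteq> index_set n m" "card J = max n m"
    "\<And>A. A \<in> carrier_mat n m \<Longrightarrow> (\<Sum>ij\<in>J. (A $$ ij)\<^sup>2) \<le> (spectral_norm A)\<^sup>2"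
    "\<And>b S. S \<subseteq> J \<Longrightarrow> mat n m (\<lambda>ij. b * of_bool (ij \<in> S)) \<in> ?\<Theta>"
    by (rule exists_line[OF h(1,2,3,7,9,4,8,10)]) (rule that; blast)
  have "J \<noteq> {}" using J(2) h(1) by auto
  note bound = minimax_over_line[OF _ h(11-13) J(1) this J(3,4), unfolded J(2)]
  \<comment> \<open>The infimum of real probabilities is bounded below through
    \<open>cINF_greatest\<close>, which asks for some estimator; the zero estimator serves.\<close>
  have "(\<lambda>_. 0\<^sub>m n m) \<in> estimators n m" by (simp add: estimators_def)
  then have ne: "estimators n m \<noteq> {}" by blast
  show "0.1 \<le> (INF \<delta>\<in>estimators n m. SUP \<theta>\<in>?\<Theta>.
      \<P>(y in law_Y n m p \<sigma> \<theta>. (spectral_norm (\<delta> y - \<theta>))\<^sup>2 \<ge> ?r))"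
  proof (rule cINF_greatest[OF ne])
    fix \<delta> assume "\<delta> \<in> estimators n m"
    then obtain \<theta> where \<theta>: "\<theta> \<in> ?\<Theta>"
      "0.1 \<le> \<P>(y in law_Y n m p \<sigma> \<theta>. (spectral_norm (\<delta> y - \<theta>))\<^sup>2 \<ge> ?r)"
      by (rule bound)
    \<comment> \<open>Comparing a member with a real supremum needs an upper bound; probabilities
      are at most 1.\<close>
    have "bdd_above ((\<lambda>\<theta>. \<P>(y in law_Y n m p \<sigma> \<theta>. (spectral_norm (\<delta> y - \<theta>))\<^sup>2 \<ge> ?r)) ` ?\<Theta>)"
      by (intro bdd_aboveI2[of _ _ 1] prob_space.prob_le_1 prob_space_law_Y h)
    from cSUP_upper2[OF this \<theta>]
    show "0.1 \<le> (SUP \<theta>\<in>?\<Theta>. \<P>(y in law_Y n m p \<sigma> \<theta>. (spectral_norm (\<delta> y - \<theta>))\<^sup>2 \<ge> ?r))" .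
  qed
  show "ennreal ?r \<le> (INF \<delta>\<in>estimators n m. SUP \<theta>\<in>?\<Theta>.
      \<integral>\<^sup>+y. ennreal ((spectral_norm (\<delta> y - \<theta>))\<^sup>2) \<partial>law_Y n m p \<sigma> \<theta>)"
  proof (rule INF_greatest)
    fix \<delta> assume "\<delta> \<in> estimators n m"
    then obtain \<theta> where \<theta>: "\<theta> \<in> ?\<Theta>"
      "ennreal ?r \<le> (\<integral>\<^sup>+y. ennreal ((spectral_norm (\<delta> y - \<theta>))\<^sup>2) \<partial>law_Y n m p \<sigma> \<theta>)"
      by (rule bound)
    then show "ennreal ?r \<le> (SUP \<theta>\<in>?\<Theta>. \<integral>\<^sup>+y. ennreal ((spectral_norm (\<delta> y - \<theta>))\<^sup>2) \<partial>law_Y n m p \<sigma> \<theta>)"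
      by (rule SUP_upper2)
  qed
qed simp

end
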